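(* Let $G=(V,E)$ be a finite graph (directed or undirected) with $V\neq\emptyset$ and without self-loops, and let $E=E_1\cup E_2\cup\cdots\cup E_m$ be a partition of its edge set into $m\ge 1$ parts. For $v\in V$ let $d(v)$ be the number of edges of $E$ incident to $v$, let $d(i,v)$ be the number of edges of $E_i$ incident to $v$, and let $\rho(v)$ be the number of indices $i$ such that $v$ is incident to at least one edge of $E_i$. Define $$RF=\frac{1}{|V|}\sum_{v\in V}\rho(v), \qquad MSIDS=\max_{1\le i\le m}\sum_{v\in V} d(i,v)^2 .$$ Then $$RF\cdot MSIDS\ \ge\ \frac{4|E|^2}{m|V|}.$$
   Context: $RF$ is the replication factor of the edge partition (vertex-cut) and $MSIDS$ is the maximal sum of inner degrees squared over the parts. Edges are counted with incidence, so that $\sum_{v\in V} d(v)=2|E|$ and $d(v)=\sum_{i=1}^m d(i,v)$. *)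

theory Defs
  imports Complex_Main "HOL-Library.Disjoint_Sets" "Graph_Theory.Digraph"
begin

text \<open>
  A graph is given by a vertex set \<open>V\<close>, a set \<open>E\<close> of edges and a map \<open>ends\<close> sending each
  edge to its set of end vertices. Orientation plays no role for incidence, so directed and
  undirected graphs are treated uniformly: \<open>loopfree_digraph_is_graph\<close> and
  \<open>undirected_is_graph\<close> below give the two instances. Since edges are counted, antiparallel
  arcs of a directed graph are two edges with the same set of ends.
\<close>

locale finite_loopfree_graph =
  fixes V :: "'v set" and E :: "'e set" and ends :: "'e \<Rightarrow> 'v set"
  assumes finite_vertices: "finite V"
    and finite_edges: "finite E"
    and ends_in_vertices: "e \<in> E \<Longrightarrow> ends e \<subseteq> V"
    and two_ends: "e \<in> E \<Longrightarrow> card (ends e) = 2"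

lemma loopfree_digraph_is_graph:
  assumes "fin_digraph G" "loopfree_digraph G"
  shows "finite_loopfree_graph (verts G) (arcs G) (\<lambda>e. {tail G e, head G e})"
proof -
  interpret fin_digraph G by fact
  interpret loopfree_digraph G by fact
  show ?thesis
    by unfold_locales (auto simp: no_loops)
qed

lemma undirected_is_graph:
  assumes "finite V" "E \<subseteq> {e. e \<subseteq> V \<and> card e = 2}"
  shows "finite_loopfree_graph V E (\<lambda>e. e)"
proof
  show "finite E"
    by (rule finite_subset[of _ "Pow V"]) (use assms in auto)
qed (use assms in auto)

text \<open>
  \<open>incidence_degree ends E v\<close> is $d(v)$, and \<open>incidence_degree ends (P i) v\<close> is $d(i,v)$.
\<close>

definition incidence_degree :: "('e \<Rightarrow> 'v set) \<Rightarrow> 'e set \<Rightarrow> 'v \<Rightarrow> nat" where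
  "incidence_degree ends F v = card {e \<in> F. v \<in> ends e}"

lemma incidence_degree_digraph:
  assumes "fin_digraph G" "loopfree_digraph G"
  shows "incidence_degree (\<lambda>e. {tail G e, head G e}) (arcs G) v = in_degree G v + out_degree G v"
proof -
  interpret fin_digraph G by fact
  interpret loopfree_digraph G by fact
  have "{e \<in> arcs G. v \<in> {tail G e, head G e}} = in_arcs G v \<union> out_arcs G v"
    by auto
  moreover have "in_arcs G v \<inter> out_arcs G v = {}"
    by (auto simp: in_arcs_def out_arcs_def) (metis no_loops)
  moreover have "finite (in_arcs G v)" "finite (out_arcs G v)"
    by (simp_all add: in_arcs_def out_arcs_def)
  ultimately show ?thesis
    by (simp add: incidence_degree_def in_degree_def out_degree_def card_Un_disjoint)
qed

text \<open>Parts are indexed by \<open>{1..m}\<close>; a part may be empty.\<close>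

definition edge_partition :: "'e set \<Rightarrow> nat \<Rightarrow> (nat \<Rightarrow> 'e set) \<Rightarrow> bool" where
  "edge_partition E m P \<longleftrightarrow> (\<Union>i\<in>{1..m}. P i) = E \<and> disjoint_family_on P {1..m}"

definition replication :: "('e \<Rightarrow> 'v set) \<Rightarrow> nat \<Rightarrow> (nat \<Rightarrow> 'e set) \<Rightarrow> 'v \<Rightarrow> nat" where
  "replication ends m P v = card {i \<in> {1..m}. \<exists>e \<in> P i. v \<in> ends e}"

definition RF :: "'v set \<Rightarrow> ('e \<Rightarrow> 'v set) \<Rightarrow> nat \<Rightarrow> (nat \<Rightarrow> 'e set) \<Rightarrow> real" where
  "RF V ends m P = 1 / real (card V) * (\<Sum>v\<in>V. real (replication ends m P v))"

definition MSIDS :: "'v set \<Rightarrow> ('e \<Rightarrow> 'v set) \<Rightarrow> nat \<Rightarrow> (nat \<Rightarrow> 'e set) \<Rightarrow> nat" where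
  "MSIDS V ends m P = Max ((\<lambda>i. \<Sum>v\<in>V. (incidence_degree ends (P i) v)\<^sup>2) ` {1..m})"

end

theory Submission
  imports Defs "HOL-Analysis.Convex"
begin

text \<open>
  Let \<open>A\<close> be the set of pairs \<open>(v, i)\<close> such that \<open>v\<close> is incident to an edge of the \<open>i\<close>-th part.
  It has $|V|\cdot RF$ elements, the degrees $d(i,v)$ vanish outside \<open>A\<close>, and they add up to
  $2|E|$ over \<open>A\<close>. By the Cauchy-Schwarz inequality
  $(2|E|)^2 \le |A| \sum_{i,v} d(i,v)^2 \le |V| \cdot RF \cdot m \cdot MSIDS$.
\<close>

text \<open>Handshake lemma by double counting incidences: each edge is counted once at each of its
  \<open>k\<close> ends. It is applied to every part separately, with \<open>k = 2\<close>.\<close>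

lemma sum_incidence_degree:
  assumes "finite V" "finite F"
    and "\<And>e. e \<in> F \<Longrightarrow> ends e \<subseteq> V" "\<And>e. e \<in> F \<Longrightarrow> card (ends e) = k"
  shows "(\<Sum>v\<in>V. incidence_degree ends F v) = k * card F"
  unfolding incidence_degree_def
proof (rule sum_multicount[OF assms(1,2)], rule ballI)
  fix e assume "e \<in> F"
  then have "{v \<in> V. v \<in> ends e} = ends e" using assms(3) by blast
  with \<open>e \<in> F\<close> show "card {v \<in> V. v \<in> ends e} = k" using assms(4) by simp
qed

text \<open>A non-incident pair has degree 0 and so contributes \<open>g 0 = 0\<close>. Keeping
  \<open>g\<close> general covers both sums in Cauchy-Schwarz: the identity for the degrees,
  squaring for their squares.\<close>

lemma sum_incidence_degree_eq_sum_incident_pairs: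
  fixes g :: "nat \<Rightarrow> 'a::comm_monoid_add"
  assumes "finite V" "finite I" "g 0 = 0"
  shows "(\<Sum>i\<in>I. \<Sum>v\<in>V. g (incidence_degree ends (P i) v))
    = (\<Sum>(v, i)\<in>(SIGMA v:V. {i \<in> I. \<exists>e\<in>P i. v \<in> ends e}).
        g (incidence_degree ends (P i) v))"
proof -
  have "g (incidence_degree ends (P i) v) = 0" if "\<not> (\<exists>e\<in>P i. v \<in> ends e)" for i v
  proof -
    have empty: "{e \<in> P i. v \<in> ends e} = {}" using that by blast
    show ?thesis unfolding incidence_degree_def empty using assms(3) by simp
  qed
  then have "(\<Sum>i\<in>I. g (incidence_degree ends (P i) v))
    = (\<Sum>i\<in>{i \<in> I. \<exists>e\<in>P i. v \<in> ends e}. g (incidence_degree ends (P i) v))" for v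
    using assms(2) by (intro sum.mono_neutral_right) auto
  \<comment> \<open>The swap makes \<open>v\<close> the outer index, matching the order of the
    dependent pairs.\<close>
  then show ?thesis
    by (subst sum.swap) (simp add: sum.Sigma assms)
qed

theorem theorem3:
  fixes V :: "'v set" and E :: "'e set" and ends :: "'e \<Rightarrow> 'v set"
    and m :: nat and P :: "nat \<Rightarrow> 'e set"
  assumes "finite_loopfree_graph V E ends"
    and "V \<noteq> {}"
    and "m \<ge> 1"
    and "edge_partition E m P"
  shows "RF V ends m P * real (MSIDS V ends m P) \<ge> 4 * (real (card E))\<^sup>2 / (real m * real (card V))"
proof -
  interpret finite_loopfree_graph V E ends by fact
  let ?d = "\<lambda>i v. incidence_degree ends (P i) v"
  define A where "A = (SIGMA v:V. {i \<in> {1..m}. \<exists>e\<in>P i. v \<in> ends e})"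
  have E_eq: "(\<Union>i\<in>{1..m}. P i) = E" and disj: "disjoint_family_on P {1..m}"
    using assms(4) by (auto simp: edge_partition_def)
  have sub: "P i \<subseteq> E" if "i \<in> {1..m}" for i
    using E_eq that by blast
  have finP: "finite (P i)" if "i \<in> {1..m}" for i
    using sub[OF that] finite_edges by (rule finite_subset)

  have "card E = (\<Sum>i\<in>{1..m}. card (P i))"
    unfolding E_eq[symmetric] using disj finP by (rule card_UN_disjoint') simp_all
  then have "2 * card E = (\<Sum>i\<in>{1..m}. 2 * card (P i))"
    by (simp add: sum_distrib_left)
  also have "\<dots> = (\<Sum>i\<in>{1..m}. \<Sum>v\<in>V. ?d i v)"
  proof (rule sum.cong[OF refl])
    fix i assume i: "i \<in> {1..m}"
    show "2 * card (P i) = (\<Sum>v\<in>V. ?d i v)"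
      by (rule sum_incidence_degree[symmetric])
        (use sub[OF i] finP[OF i] finite_vertices ends_in_vertices two_ends in auto)
  qed
  also have "\<dots> = (\<Sum>(v, i)\<in>A. ?d i v)"
    unfolding A_def
    by (rule sum_incidence_degree_eq_sum_incident_pairs[where g = "\<lambda>x. x"])
      (simp_all add: finite_vertices)
  finally have degree_sum: "2 * card E = (\<Sum>(v, i)\<in>A. ?d i v)" .

  have "(\<Sum>(v, i)\<in>A. (?d i v)\<^sup>2) = (\<Sum>i\<in>{1..m}. \<Sum>v\<in>V. (?d i v)\<^sup>2)"
    unfolding A_def
    by (rule sum_incidence_degree_eq_sum_incident_pairs[where g = "\<lambda>x. x\<^sup>2", symmetric])
      (simp_all add: finite_vertices)
  \<comment> \<open>Each of the \<open>m\<close> inner sums is at most their maximum.\<close>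
  also have "\<dots> \<le> of_nat (card {1..m}) * MSIDS V ends m P"
    by (rule sum_bounded_above) (simp add: MSIDS_def)
  finally have square_sum: "(\<Sum>(v, i)\<in>A. (?d i v)\<^sup>2) \<le> m * MSIDS V ends m P" by simp

  have card_V: "card V > 0"
    using finite_vertices \<open>V \<noteq> {}\<close> by (simp add: card_gt_0_iff)
  \<comment> \<open>The fibre of \<open>A\<close> over \<open>v\<close> is exactly the index set
    counted by \<open>replication\<close>.\<close>
  have "card A = (\<Sum>v\<in>V. replication ends m P v)"
    unfolding A_def replication_def using finite_vertices by (intro card_SigmaI) auto
  then have card_A: "real (card A) = real (card V) * RF V ends m P"
    using card_V by (simp add: RF_def)

  have "4 * (real (card E))\<^sup>2 = (\<Sum>(v, i)\<in>A. real (?d i v))\<^sup>2"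
    using arg_cong[OF degree_sum, of "\<lambda>n. (real n)\<^sup>2"]
    by (simp add: case_prod_unfold power_mult_distrib)
  \<comment> \<open>Cauchy-Schwarz against the constant 1. Summing only over \<open>A\<close>, not
    over all pairs, yields the factor \<open>card A\<close>, hence \<open>RF\<close>, instead of
    \<open>m * card V\<close>.\<close>
  also have "\<dots> \<le> (\<Sum>(v, i)\<in>A. (real (?d i v))\<^sup>2) * real (card A)"
    using sum_squared_le_sum_of_squares[of "\<lambda>(v, i). real (?d i v)" A]
    by (simp add: case_prod_unfold)
  also have "\<dots> \<le> real (m * MSIDS V ends m P) * real (card A)"
    using of_nat_mono[OF square_sum, where ?'a = real]
    by (intro mult_right_mono) (simp_all add: case_prod_unfold)
  finally show ?thesis
    using card_V \<open>m \<ge> 1\<close> by (simp add: card_A divide_le_eq mult_ac)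
qed

end
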